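(* Let $V\in\mathcal V^+\cup\mathcal V^-$ with $V\neq\mathrm{Id}$. Then for any $\mathbf x_0\in S$ the following statements hold: (i) if $V\in\mathcal V^+$, then $\omega_V(\mathbf x_0)=\omega_V^{(w)}(\mathbf x_0)\subset\partial S$. Moreover, $|\omega_V(\mathbf x_0)|=1$; (ii) if $V\in\mathcal V^-$, then: (ii)$_a$ if $\omega_V(\mathbf x_0)\neq\emptyset$, then $\omega_V(\mathbf x_0)=\omega_V^{(w)}(\mathbf x_0)\subset\partial S$; (ii)$_b$ if $\omega_V(\mathbf x_0)=\emptyset$, then there exists $r$ with $0\le r<1$ such that $\omega_V^{(w)}(\mathbf x_0)\subset\partial S_r$; (ii)$_c$ $|\omega_V^{(w)}(\mathbf x_0)|=1$.
   Context: $\ell^1$ is the space of absolutely summable real sequences $\mathbf x=(x_k)_{k\ge1}$ with norm $\|\mathbf x\|=\sum_k|x_k|$. For $r\ge0$ let $S_r=\{\mathbf x\in\ell^1: x_k\ge0\ \text{for all }k,\ \|\mathbf x\|=r\}$, $\mathrm{ri}S_r=\{\mathbf x\in S_r: x_k>0\ \text{for all }k\in\mathbb N\}$, $\partial S_r=S_r\setminus \mathrm{ri}S_r$; write $S=S_1$, $\partial S=\partial S_1$. A Volterra operator is a map $V:S\to S$ of the form $(V(\mathbf x))_k=x_k\left(1+\sum_{i=1}^\infty a_{ki}x_i\right)$, $k\in\mathbb N$, where $(a_{ki})_{k,i\in\mathbb N}$ is a real matrix with $a_{ki}=-a_{ik}$ and $|a_{ki}|\le1$ for all $k,i$; this matrix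 is uniquely determined by $V$. $\mathrm{Id}$ is the identity operator (all $a_{ki}=0$). $\mathcal V^+$ (resp. $\mathcal V^-$) is the set of Volterra operators with $a_{ki}\ge0$ (resp. $a_{ki}\le0$) for all $k<i$. For $\mathbf x_0\in S$, $\omega_V(\mathbf x_0)$ is the set of all limits, in $\ell^1$-norm, of subsequences $V^{n_j}(\mathbf x_0)$ ($n_j\to\infty$) of the trajectory $\{V^n(\mathbf x_0)\}$, where $V^n$ is the $n$-th iterate; $\omega_V^{(w)}(\mathbf x_0)$ is the set of all limits of such subsequences with respect to pointwise (coordinatewise) convergence in the space of all real sequences. $|A|$ denotes the cardinality of $A$. *)

theory Defs
  imports Complex_Main "HOL-Library.FuncSet"
begin

text \<open>
  Sequences are functions on \<^typ>\<open>nat\<close>, so coordinates are numbered from 0 instead of 1.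
  Only the order of the indices matters, and the shift preserves it.
\<close>

definition ell1 :: "(nat \<Rightarrow> real) set" where
  "ell1 = {x. summable (\<lambda>k. \<bar>x k\<bar>)}"

definition l1_norm :: "(nat \<Rightarrow> real) \<Rightarrow> real" where
  "l1_norm x = (\<Sum>k. \<bar>x k\<bar>)"

definition simplex :: "real \<Rightarrow> (nat \<Rightarrow> real) set" where
  "simplex r = {x \<in> ell1. (\<forall>k. 0 \<le> x k) \<and> l1_norm x = r}"

definition ri_simplex :: "real \<Rightarrow> (nat \<Rightarrow> real) set" where
  "ri_simplex r = {x \<in> simplex r. \<forall>k. 0 < x k}"

definition bd_simplex :: "real \<Rightarrow> (nat \<Rightarrow> real) set" where
  "bd_simplex r = simplex r - ri_simplex r"

text \<open>
  Operators on the simplex are extensional functions (arbitrary outside the simplex in one fixed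
  way), so that equality of operators is equality of HOL functions; the identity operator is
  \<open>\<lambda>x\<in>simplex 1. x\<close>.
\<close>

definition volterra_with :: "(nat \<Rightarrow> nat \<Rightarrow> real) \<Rightarrow> ((nat \<Rightarrow> real) \<Rightarrow> (nat \<Rightarrow> real)) \<Rightarrow> bool" where
  "volterra_with a V \<longleftrightarrow>
     V \<in> simplex 1 \<rightarrow>\<^sub>E simplex 1 \<and>
     (\<forall>k i. a k i = - a i k) \<and>
     (\<forall>k i. \<bar>a k i\<bar> \<le> 1) \<and>
     (\<forall>x\<in>simplex 1. \<forall>k. V x k = x k * (1 + (\<Sum>i. a k i * x i)))"

text \<open>The matrix is determined by the operator, so the existential quantifiers below range over
  at most one matrix.\<close>

definition volterra_plus :: "((nat \<Rightarrow> real) \<Rightarrow> (nat \<Rightarrow> real)) set" where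
  "volterra_plus = {V. \<exists>a. volterra_with a V \<and> (\<forall>k i. k < i \<longrightarrow> 0 \<le> a k i)}"

definition volterra_minus :: "((nat \<Rightarrow> real) \<Rightarrow> (nat \<Rightarrow> real)) set" where
  "volterra_minus = {V. \<exists>a. volterra_with a V \<and> (\<forall>k i. k < i \<longrightarrow> a k i \<le> 0)}"

definition omega :: "((nat \<Rightarrow> real) \<Rightarrow> (nat \<Rightarrow> real)) \<Rightarrow> (nat \<Rightarrow> real) \<Rightarrow> (nat \<Rightarrow> real) set" where
  "omega V x0 = {y \<in> ell1. \<exists>n. strict_mono n \<and>
     (\<lambda>j. l1_norm (\<lambda>k. (V ^^ n j) x0 k - y k)) \<longlonglongrightarrow> 0}"

definition omega_w :: "((nat \<Rightarrow> real) \<Rightarrow> (nat \<Rightarrow> real)) \<Rightarrow> (nat \<Rightarrow> real) \<Rightarrow> (nat \<Rightarrow> real) set" where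
  "omega_w V x0 = {y. \<exists>n. strict_mono n \<and> (\<forall>k. (\<lambda>j. (V ^^ n j) x0 k) \<longlonglongrightarrow> y k)}"

end

theory Submission
  imports Defs "HOL-Analysis.Uniform_Limit"
begin

text \<open>
  The idea is to follow the partial sums \<open>s m n = (\<Sum>k<m. (V ^^ n) x k)\<close> instead of single coordinates.
  By antisymmetry the interaction among the first \<open>m\<close> coordinates cancels, so one application of
  \<open>V\<close> changes such a sum only by the flow \<open>\<Sum>k<m. \<Sum>i\<ge>m. a k i * x k * x i\<close> across the cut at \<open>m\<close>.
  When the entries above the diagonal all have the same sign, every term of the flow has that sign.
  Three consequences give the theorem.

  For fixed \<open>m\<close> the sequence \<open>s m\<close> is monotone and bounded, hence convergent, and differences of
  consecutive partial sums show that every coordinate converges. The trajectory therefore has a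
  pointwise limit \<open>y\<close>, which is the only element of the weak limit set
  (\<open>trajectory_converges_pointwise\<close>, \<open>omega_w_eq_singleton\<close>).

  Since \<open>s m\<close> converges, the flow across each cut tends to 0, and since it is a sum of terms of equal
  sign, each term does: \<open>a k i * y k * y i = 0\<close> for all \<open>k < i\<close>. As \<open>V\<close> is not the identity, some
  \<open>a k i\<close> is nonzero, so \<open>y\<close> has a vanishing coordinate and lies on the boundary of the simplex of
  its own mass (\<open>limit_annihilates_matrix\<close>, \<open>limit_in_boundary\<close>).

  The mass of \<open>y\<close> is at most 1 and decides between the cases. If it is 1, then pointwise
  convergence improves to convergence in norm by Scheffe's argument, and the norm limit set is
  \<open>{y}\<close>; if it is less than 1, mass has escaped to infinity and no subsequence can converge in
  norm (\<open>omega_eq\<close>). With nonnegative entries above the diagonal the flow goes towards the small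
  indices, so no mass can escape (\<open>volterra_plus_limit_mass\<close>).
\<close>

section \<open>Sequences in the simplex\<close>

lemma simplexD:
  assumes "x \<in> simplex r"
  shows "0 \<le> x k" "summable x" "suminf x = r"
  using assms by (auto simp: simplex_def ell1_def l1_norm_def)

lemma simplexI:
  assumes "\<And>k. 0 \<le> x k" "summable x" "suminf x = r"
  shows "x \<in> simplex r"
  using assms by (auto simp: simplex_def ell1_def l1_norm_def)

lemma sum_simplex_le:
  assumes "x \<in> simplex r"
  shows "(\<Sum>k<m. x k) \<le> r"
  using sum_le_suminf[of x "{..<m}"] simplexD[OF assms] by auto

text \<open>A coordinate is the difference of two consecutive partial sums.\<close>
lemma convergent_coordinates:
  fixes X :: "nat \<Rightarrow> nat \<Rightarrow> real"
  assumes "\<And>m. convergent (\<lambda>n. \<Sum>k<m. X n k)"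
  obtains y where "\<And>k. (\<lambda>n. X n k) \<longlonglongrightarrow> y k"
proof -
  have "convergent (\<lambda>n. X n k)" for k
    using convergent_diff[OF assms[of "Suc k"] assms[of k]] by simp
  then show thesis
    using that[of "\<lambda>k. lim (\<lambda>n. X n k)"] convergent_LIMSEQ_iff by blast
qed

text \<open>
  Nonnegativity and the bounds on finite partial sums pass to a pointwise limit, the total mass
  does not: the unit vectors converge pointwise to 0.
\<close>
lemma pointwise_limit_in_simplex:
  assumes X: "\<And>n. X n \<in> simplex 1"
    and lim: "\<And>k. (\<lambda>n. X n k) \<longlonglongrightarrow> y k"
  shows "y \<in> simplex (suminf y)" "suminf y \<le> 1"
proof -
  have nonneg: "0 \<le> y k" for k
    using LIMSEQ_le_const[OF lim[of k], of 0] simplexD(1)[OF X] by blast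
  have bound: "(\<Sum>k<m. y k) \<le> 1" for m
  proof (rule LIMSEQ_le_const2)
    show "(\<lambda>n. \<Sum>k<m. X n k) \<longlonglongrightarrow> (\<Sum>k<m. y k)"
      by (intro tendsto_sum lim)
    show "\<exists>N. \<forall>n\<ge>N. (\<Sum>k<m. X n k) \<le> 1"
      using sum_simplex_le[OF X] by blast
  qed
  have "summable y"
    by (rule summableI_nonneg_bounded[OF nonneg bound])
  then show "y \<in> simplex (suminf y)" "suminf y \<le> 1"
    by (auto intro: simplexI nonneg suminf_le_const bound)
qed

text \<open>
  Scheffe's argument. Because \<open>X n\<close> and \<open>y\<close> have the same mass, the excess of \<open>X n\<close> over \<open>y\<close>
  equals its deficit, so the distance is twice the deficit. The deficit is dominated by \<open>y\<close>, which
  makes Tannery's theorem (dominated convergence for series) applicable.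
\<close>
lemma scheffe_simplex:
  assumes X: "\<And>n. X n \<in> simplex r" and y: "y \<in> simplex r"
    and lim: "\<And>k. (\<lambda>n. X n k) \<longlonglongrightarrow> y k"
  shows "(\<lambda>n. l1_norm (\<lambda>k. X n k - y k)) \<longlonglongrightarrow> 0"
proof -
  have "(\<lambda>n. \<Sum>k. max (y k - X n k) 0) \<longlonglongrightarrow> (\<Sum>k. 0)"
  proof (rule tannerys_theorem[THEN conjunct2, THEN conjunct2])
    show "((\<lambda>n. max (y k - X n k) 0) \<longlongrightarrow> 0) sequentially" for k
    proof -
      have "(\<lambda>n. max (y k - X n k) 0) \<longlonglongrightarrow> max (y k - y k) 0"
        by (intro tendsto_intros lim)
      then show ?thesis by simp
    qed
    show "\<forall>\<^sub>F (k, n) in at_top \<times>\<^sub>F sequentially. norm (max (y k - X n k) 0) \<le> y k"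
      using simplexD(1)[OF X] simplexD(1)[OF y] by (auto intro!: always_eventually)
    show "summable y" by (rule simplexD(2)[OF y])
  qed simp
  moreover have "l1_norm (\<lambda>k. X n k - y k) = 2 * (\<Sum>k. max (y k - X n k) 0)" for n
  proof -
    have pos: "summable (\<lambda>k. max (y k - X n k) 0)"
      by (rule summable_comparison_test'[OF simplexD(2)[OF y], of 0])
        (use simplexD(1)[OF X] simplexD(1)[OF y] in auto)
    have "l1_norm (\<lambda>k. X n k - y k) = (\<Sum>k. (X n k - y k) + 2 * max (y k - X n k) 0)"
      unfolding l1_norm_def by (rule arg_cong[where f = suminf]) (auto simp: fun_eq_iff max_def)
    also have "\<dots> = (suminf (X n) - suminf y) + 2 * (\<Sum>k. max (y k - X n k) 0)"
      by (intro sums_unique[symmetric] sums_add sums_diff sums_mult summable_sums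
          pos simplexD(2)[OF X] simplexD(2)[OF y])
    finally show ?thesis
      by (simp add: simplexD(3)[OF X] simplexD(3)[OF y])
  qed
  ultimately show ?thesis
    by (auto intro: tendsto_mult_right_zero)
qed

text \<open>
  In contrast to pointwise limits, norm limits preserve the mass, since summation is continuous in
  the norm.
\<close>
lemma l1_limit_imp_pointwise:
  assumes X: "\<And>n. X n \<in> simplex r" and y: "y \<in> ell1"
    and lim: "(\<lambda>n. l1_norm (\<lambda>k. X n k - y k)) \<longlonglongrightarrow> 0"
  shows "(\<lambda>n. X n k) \<longlonglongrightarrow> y k" and "y \<in> simplex r"
proof -
  have summ: "summable (\<lambda>k. \<bar>X n k - y k\<bar>)" for n
  proof (rule summable_comparison_test')
    show "summable (\<lambda>k. \<bar>X n k\<bar> + \<bar>y k\<bar>)"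
      using X[of n] y by (auto simp: simplex_def ell1_def intro: summable_add)
    show "norm \<bar>X n k - y k\<bar> \<le> \<bar>X n k\<bar> + \<bar>y k\<bar>" if "k \<ge> 0" for k by simp
  qed
  have coord: "(\<lambda>n. X n k) \<longlonglongrightarrow> y k" for k
  proof -
    have "norm (X n k - y k) \<le> l1_norm (\<lambda>k. X n k - y k)" for n
      using sum_le_suminf[OF summ[of n], of "{k}"] by (auto simp: l1_norm_def)
    then have "(\<lambda>n. X n k - y k) \<longlonglongrightarrow> 0"
      by (intro Lim_null_comparison[OF _ lim]) auto
    then show ?thesis by (simp add: LIM_zero_iff)
  qed
  then show "(\<lambda>n. X n k) \<longlonglongrightarrow> y k" .
  have nonneg: "0 \<le> y k" for k
    using LIMSEQ_le_const[OF coord[of k], of 0] simplexD(1)[OF X] by blast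
  have sy: "summable y" using y nonneg by (auto simp: ell1_def)
  have "norm (r - suminf y) \<le> l1_norm (\<lambda>k. X n k - y k)" for n
    using summable_rabs[OF summ[of n]] suminf_diff[OF simplexD(2)[OF X] sy, of n] simplexD(3)[OF X, of n]
    by (simp add: l1_norm_def)
  then have "(\<lambda>n. r - suminf y) \<longlonglongrightarrow> 0"
    by (intro Lim_null_comparison[OF _ lim]) auto
  then have "r - suminf y = 0" by (simp add: LIMSEQ_const_iff)
  then show "y \<in> simplex r" by (intro simplexI nonneg sy) simp
qed

section \<open>Partial sums along a Volterra operator\<close>

text \<open>
  Antisymmetry, as an unconditional equation between two instances of the same pattern, makes
  rewriting loop; separate facts allow it to be used only where it is wanted.
\<close>
lemma volterra_withD:
  assumes "volterra_with a V"
  shows "x \<in> simplex 1 \<Longrightarrow> V x \<in> simplex 1"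
    and "x \<in> simplex 1 \<Longrightarrow> V x k = x k * (1 + (\<Sum>i. a k i * x i))"
    and "x \<notin> simplex 1 \<Longrightarrow> V x = undefined"
    and "a k i = - a i k"
    and "\<bar>a k i\<bar> \<le> 1"
  using assms unfolding volterra_with_def by (blast dest: PiE_mem PiE_arb)+

lemma funpow_simplex:
  assumes "volterra_with a V" "x \<in> simplex 1"
  shows "(V ^^ n) x \<in> simplex 1"
  using assms by (induction n) (auto intro: volterra_withD(1))

lemma antisymmetric_double_sum_zero:
  fixes b :: "'a \<Rightarrow> 'a \<Rightarrow> real"
  assumes "\<And>k i. b k i = - b i k"
  shows "(\<Sum>k\<in>A. \<Sum>i\<in>A. b k i) = 0"
proof -
  have "(\<Sum>k\<in>A. \<Sum>i\<in>A. b k i) = (\<Sum>k\<in>A. \<Sum>i\<in>A. b i k)"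
    by (rule sum.swap)
  also have "\<dots> = - (\<Sum>k\<in>A. \<Sum>i\<in>A. b k i)"
    by (simp only: sum_negf[symmetric] assms[symmetric])
  finally show ?thesis by simp
qed

lemma volterra_summable:
  assumes "volterra_with a V" "x \<in> simplex 1"
  shows "summable (\<lambda>i. a k i * x i)"
proof (rule summable_comparison_test'[OF simplexD(2)[OF assms(2)], of 0])
  show "norm (a k i * x i) \<le> x i" for i
    using mult_right_mono[OF volterra_withD(5)[OF assms(1)] simplexD(1)[OF assms(2)], of k i i]
    by (simp add: abs_mult simplexD(1)[OF assms(2)])
qed

text \<open>
  The flow across the cut at \<open>m\<close>: interactions between coordinates below \<open>m\<close> redistribute mass
  among them and cancel in the sum.
\<close>
lemma partial_sum_increment:
  assumes V: "volterra_with a V" and x: "x \<in> simplex 1"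
  shows "(\<Sum>k<m. V x k) - (\<Sum>k<m. x k) = (\<Sum>k<m. x k * (\<Sum>i. a k (i + m) * x (i + m)))"
proof -
  have "(\<Sum>k<m. V x k) - (\<Sum>k<m. x k) = (\<Sum>k<m. x k * (\<Sum>i. a k i * x i))"
    by (simp add: volterra_withD(2)[OF V x] algebra_simps sum.distrib)
  also have "\<dots> = (\<Sum>k<m. \<Sum>i<m. x k * (a k i * x i))
      + (\<Sum>k<m. x k * (\<Sum>i. a k (i + m) * x (i + m)))"
    by (subst suminf_split_initial_segment[OF volterra_summable[OF V x], of _ m])
      (simp add: algebra_simps sum.distrib sum_distrib_left)
  also have "(\<Sum>k<m. \<Sum>i<m. x k * (a k i * x i)) = 0"
  proof (rule antisymmetric_double_sum_zero)
    show "x k * (a k i * x i) = - (x i * (a i k * x k))" for k i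
      by (subst volterra_withD(4)[OF V]) simp
  qed
  finally show ?thesis by simp
qed

text \<open>
  The factor \<open>c\<close> carries the sign of the entries above the diagonal, so that \<open>c = 1\<close> and
  \<open>c = - 1\<close> treat both classes of operators at once. The flow is a sum of terms of this sign and
  thus dominates each of them.
\<close>
lemma partial_sum_increment_ge:
  assumes V: "volterra_with a V" and x: "x \<in> simplex 1"
    and sign: "\<And>k i. k < i \<Longrightarrow> 0 \<le> c * a k i"
    and "k < m" "m \<le> i"
  shows "c * a k i * x k * x i \<le> c * ((\<Sum>k<m. V x k) - (\<Sum>k<m. x k))"
proof -
  note nonneg = simplexD(1)[OF x]
  have summ: "summable (\<lambda>j. c * a l (j + m) * x (j + m))" for l
    using summable_mult[OF summable_ignore_initial_segment[OF volterra_summable[OF V x], of l m], of c]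
    by (simp add: mult.assoc)
  have terms: "0 \<le> c * a l (j + m) * x (j + m)" if "l < m" for l j
    using sign[of l "j + m"] that nonneg by simp
  have "c * a k i * x i = (\<Sum>j\<in>{i - m}. c * a k (j + m) * x (j + m))"
    using \<open>m \<le> i\<close> by simp
  also have "\<dots> \<le> (\<Sum>j. c * a k (j + m) * x (j + m))"
    by (rule sum_le_suminf[OF summ]) (use terms[OF \<open>k < m\<close>] in auto)
  finally have single: "c * a k i * x i \<le> (\<Sum>j. c * a k (j + m) * x (j + m))" .
  have "c * a k i * x k * x i = x k * (c * a k i * x i)"
    by (simp only: mult_ac)
  also have "\<dots> \<le> x k * (\<Sum>j. c * a k (j + m) * x (j + m))"
    by (rule mult_left_mono[OF single nonneg])
  also have "\<dots> \<le> (\<Sum>l<m. x l * (\<Sum>j. c * a l (j + m) * x (j + m)))"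
  proof (rule member_le_sum)
    show "0 \<le> x l * (\<Sum>j. c * a l (j + m) * x (j + m))" if "l \<in> {..<m} - {k}" for l
      using that by (intro mult_nonneg_nonneg nonneg suminf_nonneg summ terms) auto
  qed (use \<open>k < m\<close> in auto)
  also have "\<dots> = c * ((\<Sum>k<m. V x k) - (\<Sum>k<m. x k))"
    unfolding partial_sum_increment[OF V x] sum_distrib_left
  proof (rule sum.cong[OF refl])
    fix l
    have "(\<Sum>j. c * a l (j + m) * x (j + m)) = c * (\<Sum>j. a l (j + m) * x (j + m))"
      using suminf_mult[OF summable_ignore_initial_segment[OF volterra_summable[OF V x], of l m], of c]
      by (simp only: mult.assoc)
    then show "x l * (\<Sum>j. c * a l (j + m) * x (j + m)) = c * (x l * (\<Sum>j. a l (j + m) * x (j + m)))"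
      by simp
  qed
  finally show ?thesis .
qed

lemma partial_sums_monotone:
  assumes V: "volterra_with a V" and x: "x \<in> simplex 1"
    and sign: "\<And>k i. k < i \<Longrightarrow> 0 \<le> c * a k i"
  shows "incseq (\<lambda>n. c * (\<Sum>k<m. (V ^^ n) x k))"
proof (rule incseq_SucI)
  fix n
  note xn = funpow_simplex[OF V x, of n]
  have "0 \<le> c * ((\<Sum>k<m. V ((V ^^ n) x) k) - (\<Sum>k<m. (V ^^ n) x k))"
  proof (cases "m = 0")
    case False
    \<comment> \<open>Any pair separated by the cut would do; its contribution is a nonnegative lower bound.\<close>
    have "0 \<le> c * a 0 m * (V ^^ n) x 0 * (V ^^ n) x m"
      using sign[of 0 m] False simplexD(1)[OF xn] by simp
    also have "\<dots> \<le> c * ((\<Sum>k<m. V ((V ^^ n) x) k) - (\<Sum>k<m. (V ^^ n) x k))"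
      using False by (intro partial_sum_increment_ge[OF V xn sign]) auto
    finally show ?thesis .
  qed simp
  then show "c * (\<Sum>k<m. (V ^^ n) x k) \<le> c * (\<Sum>k<m. (V ^^ Suc n) x k)"
    by (simp add: algebra_simps)
qed

text \<open>Up to the sign of \<open>c\<close> the partial sums increase, and they stay between 0 and 1.\<close>
lemma trajectory_converges_pointwise:
  assumes V: "volterra_with a V" and x: "x \<in> simplex 1"
    and sign: "\<And>k i. k < i \<Longrightarrow> 0 \<le> c * a k i" and "c \<noteq> 0"
  obtains y where "\<And>k. (\<lambda>n. (V ^^ n) x k) \<longlonglongrightarrow> y k"
proof (rule convergent_coordinates)
  fix m
  have "c * (\<Sum>k<m. (V ^^ n) x k) \<le> \<bar>c\<bar>" for n
  proof -
    note xn = funpow_simplex[OF V x, of n]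
    have "c * (\<Sum>k<m. (V ^^ n) x k) \<le> \<bar>c\<bar> * (\<Sum>k<m. (V ^^ n) x k)"
      by (intro mult_right_mono sum_nonneg) (auto simp: simplexD(1)[OF xn])
    also have "\<dots> \<le> \<bar>c\<bar> * 1"
      by (intro mult_left_mono sum_simplex_le[OF xn]) auto
    finally show ?thesis by simp
  qed
  then have "convergent (\<lambda>n. c * (\<Sum>k<m. (V ^^ n) x k))"
    using incseq_convergent[OF partial_sums_monotone[OF V x sign], of m "\<bar>c\<bar>"]
    by (metis convergent_def)
  then show "convergent (\<lambda>n. \<Sum>k<m. (V ^^ n) x k)"
    using convergent_mult_const_iff[OF \<open>c \<noteq> 0\<close>] by blast
qed (rule that)

text \<open>
  Cut at \<open>i\<close>, so that \<open>k\<close> is below the cut and \<open>i\<close> is not. The flow across the cut is the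
  difference of consecutive terms of a convergent sequence and tends to 0; the single term is
  squeezed between 0 and the flow.
\<close>
lemma limit_annihilates_matrix:
  assumes V: "volterra_with a V" and x: "x \<in> simplex 1"
    and sign: "\<And>k i. k < i \<Longrightarrow> 0 \<le> c * a k i" and "c \<noteq> 0"
    and lim: "\<And>k. (\<lambda>n. (V ^^ n) x k) \<longlonglongrightarrow> y k"
    and "k < i"
  shows "a k i * y k * y i = 0"
proof -
  let ?s = "\<lambda>n. \<Sum>l<i. (V ^^ n) x l"
  have s: "?s \<longlonglongrightarrow> (\<Sum>l<i. y l)"
    by (intro tendsto_sum lim)
  have "(\<lambda>n. c * (?s (Suc n) - ?s n)) \<longlonglongrightarrow> c * ((\<Sum>l<i. y l) - (\<Sum>l<i. y l))"
    by (intro tendsto_intros LIMSEQ_Suc[OF s] s)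
  then have incr: "(\<lambda>n. c * (?s (Suc n) - ?s n)) \<longlonglongrightarrow> 0" by simp
  have "(\<lambda>n. c * a k i * (V ^^ n) x k * (V ^^ n) x i) \<longlonglongrightarrow> 0"
  proof (rule tendsto_sandwich[OF _ _ tendsto_const incr])
    show "\<forall>\<^sub>F n in sequentially. 0 \<le> c * a k i * (V ^^ n) x k * (V ^^ n) x i"
      using sign[OF \<open>k < i\<close>] simplexD(1)[OF funpow_simplex[OF V x]]
      by (auto intro!: always_eventually mult_nonneg_nonneg)
    show "\<forall>\<^sub>F n in sequentially. c * a k i * (V ^^ n) x k * (V ^^ n) x i \<le> c * (?s (Suc n) - ?s n)"
      using partial_sum_increment_ge[OF V funpow_simplex[OF V x] sign \<open>k < i\<close>, of i]
      by (auto intro!: always_eventually)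
  qed
  moreover have "(\<lambda>n. c * a k i * (V ^^ n) x k * (V ^^ n) x i) \<longlonglongrightarrow> c * a k i * y k * y i"
    by (intro tendsto_intros lim)
  ultimately have "c * a k i * y k * y i = 0"
    using LIMSEQ_unique by blast
  with \<open>c \<noteq> 0\<close> show ?thesis by simp
qed

lemma nonzero_entry_above_diagonal:
  assumes V: "volterra_with a V" and "V \<noteq> (\<lambda>x\<in>simplex 1. x)"
  obtains k i where "k < i" "a k i \<noteq> 0"
proof (rule ccontr)
  assume *: "\<not> thesis"
  have "a k i = 0" for k i
  proof (cases k i rule: linorder_cases)
    case less
    with * that show ?thesis by blast
  next
    case equal
    have "a k k = - a k k" by (rule volterra_withD(4)[OF V])
    with equal show ?thesis by simp
  next
    case greater
    then have "a i k = 0" using * that by blast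
    moreover have "a k i = - a i k" by (rule volterra_withD(4)[OF V])
    ultimately show ?thesis by simp
  qed
  then have "V x = (\<lambda>x\<in>simplex 1. x) x" for x
    using volterra_withD(2,3)[OF V, of x] by (cases "x \<in> simplex 1") (simp_all add: fun_eq_iff)
  with assms(2) show False by blast
qed

lemma limit_in_boundary:
  assumes V: "volterra_with a V" "V \<noteq> (\<lambda>x\<in>simplex 1. x)" and x: "x \<in> simplex 1"
    and sign: "\<And>k i. k < i \<Longrightarrow> 0 \<le> c * a k i" "c \<noteq> 0"
    and lim: "\<And>k. (\<lambda>n. (V ^^ n) x k) \<longlonglongrightarrow> y k"
  shows "y \<in> bd_simplex (suminf y)"
proof -
  obtain k i where "k < i" "a k i \<noteq> 0"
    using nonzero_entry_above_diagonal[OF V] .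
  then have "y k = 0 \<or> y i = 0"
    using limit_annihilates_matrix[OF V(1) x sign lim] by auto
  then have "\<not> (\<forall>l. 0 < y l)"
    by (metis less_irrefl)
  then show ?thesis
    using pointwise_limit_in_simplex(1)[OF funpow_simplex[OF V(1) x] lim]
    by (simp add: bd_simplex_def ri_simplex_def)
qed

section \<open>Limit sets\<close>

lemma omega_w_eq_singleton:
  assumes "\<And>k. (\<lambda>n. (V ^^ n) x k) \<longlonglongrightarrow> y k"
  shows "omega_w V x = {y}"
proof -
  have sub: "(\<lambda>j. (V ^^ n j) x k) \<longlonglongrightarrow> y k" if "strict_mono n" for n k
    using LIMSEQ_subseq_LIMSEQ[OF assms that] by (simp add: comp_def)
  have "z = y" if z: "z \<in> omega_w V x" for z
  proof
    fix k
    show "z k = y k"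
      using z sub LIMSEQ_unique unfolding omega_w_def by blast
  qed
  moreover have "y \<in> omega_w V x"
    using assms strict_mono_id by (auto simp: omega_w_def intro!: exI[of _ "\<lambda>j. j"] strict_monoI)
  ultimately show ?thesis by blast
qed

text \<open>
  A norm limit of a subsequence is also its pointwise limit, hence \<open>y\<close>, and has mass 1.
  Conversely, if \<open>y\<close> has mass 1, the whole trajectory converges to it in norm by Scheffe's
  argument.
\<close>
lemma omega_eq:
  assumes X: "\<And>n. (V ^^ n) x \<in> simplex 1"
    and lim: "\<And>k. (\<lambda>n. (V ^^ n) x k) \<longlonglongrightarrow> y k"
  shows "omega V x = (if suminf y = 1 then {y} else {})"
proof -
  have "z = y \<and> suminf y = 1" if "z \<in> omega V x" for z
  proof -
    from that obtain n where n: "z \<in> ell1" "strict_mono n"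
      "(\<lambda>j. l1_norm (\<lambda>k. (V ^^ n j) x k - z k)) \<longlonglongrightarrow> 0"
      by (auto simp: omega_def)
    note z = l1_limit_imp_pointwise[of "\<lambda>j. (V ^^ n j) x", OF X n(1,3)]
    have "z \<in> omega_w V x"
      using z(1) n(2) by (auto simp: omega_w_def)
    then have "z = y" using omega_w_eq_singleton[OF lim] by simp
    with z(2) show ?thesis by (auto dest: simplexD(3))
  qed
  moreover have "y \<in> omega V x" if "suminf y = 1"
  proof -
    have y: "y \<in> simplex 1"
      using pointwise_limit_in_simplex(1)[OF X lim] that by simp
    then show ?thesis
      using scheffe_simplex[OF X y lim]
      by (auto simp: omega_def simplex_def intro!: exI[of _ "\<lambda>j. j"] strict_monoI)
  qed
  ultimately show ?thesis by auto
qed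

text \<open>
  Increasing partial sums keep mass from escaping to infinity: in the limit each is at least what it
  was at the starting point, and those initial partial sums exhaust the mass 1.
\<close>
lemma volterra_plus_limit_mass:
  assumes V: "volterra_with a V" and x: "x \<in> simplex 1"
    and sign: "\<And>k i. k < i \<Longrightarrow> 0 \<le> a k i"
    and lim: "\<And>k. (\<lambda>n. (V ^^ n) x k) \<longlonglongrightarrow> y k"
  shows "suminf y = 1"
proof (rule antisym)
  note y = pointwise_limit_in_simplex[OF funpow_simplex[OF V x] lim]
  show "suminf y \<le> 1" by (rule y(2))
  have "(\<Sum>k<m. x k) \<le> suminf y" for m
  proof -
    have "incseq (\<lambda>n. \<Sum>k<m. (V ^^ n) x k)"
      using partial_sums_monotone[OF V x, of 1] sign by simp
    moreover have "(\<lambda>n. \<Sum>k<m. (V ^^ n) x k) \<longlonglongrightarrow> (\<Sum>k<m. y k)"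
      by (intro tendsto_sum lim)
    ultimately have "(\<Sum>k<m. (V ^^ 0) x k) \<le> (\<Sum>k<m. y k)"
      by (rule incseq_le)
    also have "\<dots> \<le> suminf y" by (rule sum_simplex_le[OF y(1)])
    finally show ?thesis by simp
  qed
  then have "suminf x \<le> suminf y"
    by (intro suminf_le_const simplexD(2)[OF x])
  then show "1 \<le> suminf y" by (simp add: simplexD(3)[OF x])
qed

theorem theorem1p3:
  fixes V :: "(nat \<Rightarrow> real) \<Rightarrow> (nat \<Rightarrow> real)" and x0 :: "nat \<Rightarrow> real"
  assumes "V \<in> volterra_plus \<union> volterra_minus"
    and "V \<noteq> (\<lambda>x\<in>simplex 1. x)"
    and "x0 \<in> simplex 1"
  shows "(V \<in> volterra_plus \<longrightarrow>
            omega V x0 = omega_w V x0 \<and> omega_w V x0 \<subseteq> bd_simplex 1 \<and> card (omega V x0) = 1) \<and>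
         (V \<in> volterra_minus \<longrightarrow>
            (omega V x0 \<noteq> {} \<longrightarrow>
               omega V x0 = omega_w V x0 \<and> omega_w V x0 \<subseteq> bd_simplex 1) \<and>
            (omega V x0 = {} \<longrightarrow>
               (\<exists>r. 0 \<le> r \<and> r < 1 \<and> omega_w V x0 \<subseteq> bd_simplex r)) \<and>
            card (omega_w V x0) = 1)"
proof (rule conjI; rule impI)
  assume "V \<in> volterra_plus"
  then obtain a where V: "volterra_with a V" and sign: "\<And>k i. k < i \<Longrightarrow> 0 \<le> a k i"
    by (auto simp: volterra_plus_def)
  have sign': "0 \<le> 1 * a k i" if "k < i" for k i using sign[OF that] by simp
  obtain y where y: "\<And>k. (\<lambda>n. (V ^^ n) x0 k) \<longlonglongrightarrow> y k"
    using trajectory_converges_pointwise[OF V assms(3) sign'] by auto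
  have mass: "suminf y = 1"
    by (rule volterra_plus_limit_mass[OF V assms(3) sign y])
  have "y \<in> bd_simplex 1"
    using limit_in_boundary[OF V assms(2,3) sign' _ y] mass by simp
  then show "omega V x0 = omega_w V x0 \<and> omega_w V x0 \<subseteq> bd_simplex 1 \<and> card (omega V x0) = 1"
    using omega_eq[OF funpow_simplex[OF V assms(3)] y] omega_w_eq_singleton[OF y] mass by simp
next
  assume "V \<in> volterra_minus"
  then obtain a where V: "volterra_with a V" and sign: "\<And>k i. k < i \<Longrightarrow> 0 \<le> - 1 * a k i"
    by (auto simp: volterra_minus_def)
  obtain y where y: "\<And>k. (\<lambda>n. (V ^^ n) x0 k) \<longlonglongrightarrow> y k"
    using trajectory_converges_pointwise[OF V assms(3) sign] by auto
  note X = funpow_simplex[OF V assms(3)]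
  have bd: "y \<in> bd_simplex (suminf y)"
    using limit_in_boundary[OF V assms(2,3) sign _ y] by simp
  have "0 \<le> suminf y"
    using simplexD[OF pointwise_limit_in_simplex(1)[OF X y]] by (simp add: suminf_nonneg)
  then show "(omega V x0 \<noteq> {} \<longrightarrow>
               omega V x0 = omega_w V x0 \<and> omega_w V x0 \<subseteq> bd_simplex 1) \<and>
            (omega V x0 = {} \<longrightarrow>
               (\<exists>r. 0 \<le> r \<and> r < 1 \<and> omega_w V x0 \<subseteq> bd_simplex r)) \<and>
            card (omega_w V x0) = 1"
    using omega_eq[OF X y] omega_w_eq_singleton[OF y] pointwise_limit_in_simplex(2)[OF X y] bd
    by (cases "suminf y = 1") (auto intro!: exI[of _ "suminf y"])
qed

end
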